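(* Let $f$ be as in the context. The subdivision (recursion) tree $T_{\textsc{Dcm}}$ induced by the algorithm $\textsc{Dcm}$ applied to $f$ has height $O(\log n-\log\sigma_f)$ and size (number of nodes) $O(\Sigma_f+n\log n)$.
   Context: Let $F(x)=\sum_{i=0}^nA_ix^i\in\mathbb{R}[x]$ be square-free of degree $n\ge2$ with $|A_n|\ge1$ and complex roots $\xi_i$; let $\Gamma$ be an integer with $\log_2\max_i|\xi_i|\le\Gamma<4\log_2n+\log_2\max_i|\xi_i|$ and $f(x):=F(2^{\Gamma+1}x)/A_n$, with roots $z_1,\dots,z_n$. $\sigma(z_i,f)$ is the minimal distance from $z_i$ to another root, $\sigma_f=\min_i\sigma(z_i,f)$, $\Sigma_f:=-\sum_{i=1}^n\log_2\sigma(z_i,f)$; logarithms are base 2. Notation: for $I=(a,b)$, $w(I)=b-a$, $m(I)=(a+b)/2$, $I^+=(a^+,b^+):=(a-\frac{w(I)}{4n},b+\frac{w(I)}{4n})$, $f_I(x):=f(a+w(I)x)$; $\operatorname{var}(p)$ is the number of sign changes in the coefficient sequence of a real polynomial $p$ and $\operatorname{var}(f,I):=\operatorname{var}((1+x)^nf_I(\frac1{1+x}))$; $t_{3/2}^p(m,r):=|p(m)|-\frac32\sum_{k\ge1}|p^{(k)}(m)/k!|r^k$ and $\mathcal{T}^p(m,r)$ holds iff $t_{3/2}^p(m,r)>0$. Algorithm $\textsc{Dcm}$: keep active set $\mathcal{A}$, initially $\{(-\frac12,\frac12)\}$, and $\mathcal{O}=\emptyset$. Repeatedly remove some $I=(a,b)$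 from $\mathcal{A}$: if $\operatorname{var}(f,I^+)=0$, discard $I$; otherwise, if $\mathcal{T}^{(f_I)'}(0,2)$ fails, add the two halves $(a,m(I))$, $(m(I),b)$ to $\mathcal{A}$ (these are the children of $I$ in the tree); otherwise, if $f(a^+)f(b^+)<0$ and $I^+$ is disjoint from all intervals in $\mathcal{O}$, add $I^+$ to $\mathcal{O}$, else discard $I$. Stop when $\mathcal{A}$ is empty. The tree $T_{\textsc{Dcm}}$ has as nodes all intervals ever removed from $\mathcal{A}$, rooted at $(-\frac12,\frac12)$. *)

theory Defs
  imports
    "HOL-Analysis.Analysis"
    "HOL-Computational_Algebra.Computational_Algebra"
begin

definition complex_roots :: "real poly \<Rightarrow> complex set" where
  "complex_roots p = {z. poly (map_poly complex_of_real p) z = 0}"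

definition max_root_modulus :: "real poly \<Rightarrow> real" where
  "max_root_modulus p = Max (cmod ` complex_roots p)"

text \<open>The separations below are meaningful for square-free polynomials of degree at least 2: these
  have at least two complex roots, and all roots are simple, so that indexing by the set of roots
  agrees with indexing by a list of roots.\<close>

definition root_sep :: "complex \<Rightarrow> real poly \<Rightarrow> real" where
  "root_sep z p = Min ((\<lambda>y. dist z y) ` (complex_roots p - {z}))"

definition min_root_sep :: "real poly \<Rightarrow> real" where
  "min_root_sep p = Min ((\<lambda>z. root_sep z p) ` complex_roots p)"

definition sum_log_sep :: "real poly \<Rightarrow> real" where
  "sum_log_sep p = - (\<Sum>z\<in>complex_roots p. log 2 (root_sep z p))"

definition scaled_poly :: "real poly \<Rightarrow> int \<Rightarrow> real poly" where
  "scaled_poly F \<Gamma> = smult (1 / lead_coeff F) (F \<circ>\<^sub>p [:0, 2 powi (\<Gamma> + 1):])"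

text \<open>A pair \<open>(a, b)\<close> stands for the open interval from \<open>a\<close> to \<open>b\<close>.\<close>

type_synonym interval = "real \<times> real"

definition width :: "interval \<Rightarrow> real" where
  "width I = snd I - fst I"

definition midpt :: "interval \<Rightarrow> real" where
  "midpt I = (fst I + snd I) / 2"

definition enlarge :: "nat \<Rightarrow> interval \<Rightarrow> interval" where
  "enlarge n I = (fst I - width I / (4 * real n), snd I + width I / (4 * real n))"

definition points :: "interval \<Rightarrow> real set" where
  "points I = {fst I <..< snd I}"

definition restrict_poly :: "real poly \<Rightarrow> interval \<Rightarrow> real poly" where
  "restrict_poly f I = f \<circ>\<^sub>p [:fst I, width I:]"

text \<open>Zero coefficients are skipped when counting sign changes.\<close>

definition sign_var :: "real poly \<Rightarrow> nat" where
  "sign_var p = (let cs = filter (\<lambda>c. c \<noteq> 0) (coeffs p)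
     in card {i. Suc i < length cs \<and> cs ! i * cs ! Suc i < 0})"

text \<open>With \<open>n = degree f\<close> and \<open>c k\<close> the coefficients of \<open>restrict_poly f I\<close>, the polynomial
  \<open>(1 + x) ^ n * restrict_poly f I (1 / (1 + x))\<close> is the sum of the \<open>c k * (1 + x) ^ (n - k)\<close>.\<close>

definition descartes_poly :: "real poly \<Rightarrow> interval \<Rightarrow> real poly" where
  "descartes_poly f I =
     (\<Sum>k\<le>degree f. smult (coeff (restrict_poly f I) k) ([:1, 1:] ^ (degree f - k)))"

definition var_on :: "real poly \<Rightarrow> interval \<Rightarrow> nat" where
  "var_on f I = sign_var (descartes_poly f I)"

definition t_test_val :: "real poly \<Rightarrow> real \<Rightarrow> real \<Rightarrow> real" where
  "t_test_val p m r =
     \<bar>poly p m\<bar> - 3/2 * (\<Sum>k=1..degree p. \<bar>poly ((pderiv ^^ k) p) m / fact k\<bar> * r ^ k)"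

definition t_test :: "real poly \<Rightarrow> real \<Rightarrow> real \<Rightarrow> bool" where
  "t_test p m r \<longleftrightarrow> t_test_val p m r > 0"

text \<open>The algorithm as a nondeterministic transition system. Besides the active and the isolating
  intervals, a state records the subdivision tree generated so far: the intervals removed from the
  active set, and the parent-child pairs.\<close>

record dcm_state =
  active :: "interval set"
  isolating :: "interval set"
  nodes :: "interval set"
  edges :: "(interval \<times> interval) set"

definition dcm_root :: interval where
  "dcm_root = (-1/2, 1/2)"

definition dcm_init :: dcm_state where
  "dcm_init = \<lparr>active = {dcm_root}, isolating = {}, nodes = {}, edges = {}\<rparr>"

definition dcm_process :: "real poly \<Rightarrow> interval \<Rightarrow> dcm_state \<Rightarrow> dcm_state" where
  "dcm_process f I s =
    (let J = enlarge (degree f) I;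
         s' = s\<lparr>active := active s - {I}, nodes := insert I (nodes s)\<rparr>;
         L = (fst I, midpt I);
         R = (midpt I, snd I)
     in if var_on f J = 0 then s'
        else if \<not> t_test (pderiv (restrict_poly f I)) 0 2
        then s'\<lparr>active := active s' \<union> {L, R}, edges := edges s' \<union> {(I, L), (I, R)}\<rparr>
        else if poly f (fst J) * poly f (snd J) < 0 \<and> (\<forall>K\<in>isolating s'. points J \<inter> points K = {})
        then s'\<lparr>isolating := insert J (isolating s')\<rparr>
        else s')"

definition dcm_step :: "real poly \<Rightarrow> dcm_state \<Rightarrow> dcm_state \<Rightarrow> bool" where
  "dcm_step f s s' \<longleftrightarrow> (\<exists>I\<in>active s. s' = dcm_process f I s)"

definition dcm_terminates :: "real poly \<Rightarrow> bool" where
  "dcm_terminates f \<longleftrightarrow> \<not> (\<exists>S. S 0 = dcm_init \<and> (\<forall>k::nat. dcm_step f (S k) (S (Suc k))))"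

definition dcm_final :: "real poly \<Rightarrow> dcm_state \<Rightarrow> bool" where
  "dcm_final f s \<longleftrightarrow> (dcm_step f)\<^sup>*\<^sup>* dcm_init s \<and> active s = {}"

text \<open>The height counts edges: a tree consisting of the root alone has height 0.\<close>

definition tree_height :: "dcm_state \<Rightarrow> nat" where
  "tree_height s = Max {k. \<exists>I\<in>nodes s. (dcm_root, I) \<in> edges s ^^ k}"

definition tree_size :: "dcm_state \<Rightarrow> nat" where
  "tree_size s = card (nodes s)"

end

theory Submission
  imports Defs
begin

text \<open>
  Let \<open>I\<close> be an interval of width \<open>w\<close> that is subdivided. By the one-circle theorem \<open>f\<close> has a root
  \<open>z\<close> at distance less than \<open>w\<close> from the midpoint of \<open>I\<close>. As the test on the derivative fails, \<open>f'\<close>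
  has a root within \<open>8 n w\<close> of the left endpoint of \<open>I\<close>; but a root of \<open>f'\<close> has distance at least
  \<open>\<sigma>(z, f) / n\<close> from the simple root \<open>z\<close>. Hence \<open>\<sigma>(z, f) \<le> 9 n\<^sup>2 w\<close>. This bounds the depth of \<open>I\<close> by
  \<open>log (9 n\<^sup>2 / \<sigma>(z, f))\<close>, and as only three dyadic intervals of each width can be that close to \<open>z\<close>,
  summation over \<open>z\<close> bounds the number of subdivided intervals.
\<close>

subsection \<open>Complex polynomials\<close>

abbreviation cpoly :: "real poly \<Rightarrow> complex poly" where
  "cpoly \<equiv> map_poly complex_of_real"

lemma coeff_cpoly [simp]: "coeff (cpoly p) k = complex_of_real (coeff p k)"
  by (simp add: coeff_map_poly)

lemma degree_cpoly [simp]: "degree (cpoly p) = degree p"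
  by (simp add: degree_map_poly)

lemma cpoly_eq_0_iff [simp]: "cpoly p = 0 \<longleftrightarrow> p = 0"
  by (simp add: map_poly_eq_0_iff)

lemma cpoly_pCons [simp]: "cpoly (pCons c p) = pCons (complex_of_real c) (cpoly p)"
  by (simp add: map_poly_pCons)

lemma cpoly_smult: "cpoly (smult c p) = smult (complex_of_real c) (cpoly p)"
  by (simp add: map_poly_smult)

lemma cpoly_add: "cpoly (p + q) = cpoly p + cpoly q"
  by (simp add: poly_eq_iff)

lemma cpoly_mult: "cpoly (p * q) = cpoly p * cpoly q"
  by (simp add: poly_eq_iff coeff_mult)

lemma cpoly_power: "cpoly (p ^ k) = cpoly p ^ k"
  by (induction k) (simp_all add: cpoly_mult)

lemma cpoly_sum: "cpoly (sum g A) = (\<Sum>k\<in>A. cpoly (g k))"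
  by (induction A rule: infinite_finite_induct) (simp_all add: cpoly_add)

lemma cpoly_pcompose: "cpoly (pcompose p q) = pcompose (cpoly p) (cpoly q)"
  by (induction p) (simp_all add: pcompose_pCons cpoly_add cpoly_mult)

lemma cpoly_pderiv: "cpoly (pderiv p) = pderiv (cpoly p)"
  by (simp add: poly_eq_iff coeff_pderiv)

lemma poly_cpoly_of_real: "poly (cpoly p) (complex_of_real x) = complex_of_real (poly p x)"
  by (induction p) simp_all

lemma complex_poly_root_exists:
  fixes p :: "complex poly"
  assumes "degree p > 0"
  obtains z where "poly p z = 0"
proof -
  have "\<not> constant (poly p)"
    using assms by (simp add: constant_degree)
  then show thesis
    using fundamental_theorem_of_algebra that by blast
qed

lemma complex_poly_linear_factor:
  fixes p :: "complex poly"
  assumes "degree p = Suc d"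
  obtains c q where "p = [:-c, 1:] * q" "degree q = d" "q \<noteq> 0" "poly p c = 0"
proof -
  obtain c where c: "poly p c = 0"
    using complex_poly_root_exists[of p] assms by auto
  then obtain q where q: "p = [:-c, 1:] * q"
    unfolding poly_eq_0_iff_dvd by (elim dvdE)
  have "q \<noteq> 0" using q assms by auto
  moreover have "degree p = 1 + degree q"
    unfolding q using \<open>q \<noteq> 0\<close> by (subst degree_mult_eq) auto
  ultimately show thesis using that q c assms by simp
qed

text \<open>The norm with weights \<open>r ^ k\<close> on the coefficients is submultiplicative, so it suffices to
  look at linear factors.\<close>

lemma weighted_coeff_sum_le:
  fixes p :: "complex poly"
  assumes "p \<noteq> 0" "r \<ge> 0" "R > 0" "\<And>z. poly p z = 0 \<Longrightarrow> R \<le> norm z"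
  shows "(\<Sum>k\<le>degree p. norm (coeff p k) * r ^ k) \<le> norm (coeff p 0) * (1 + r / R) ^ degree p"
  using assms(1,4)
proof (induction "degree p" arbitrary: p)
  case 0
  then show ?case by simp
next
  case (Suc d)
  obtain c q where p: "p = [:-c, 1:] * q" and q: "degree q = d" "q \<noteq> 0" and c: "poly p c = 0"
    using complex_poly_linear_factor Suc.hyps(2) by metis
  have "R \<le> norm c" using Suc.prems(2) c by blast
  have coeff0: "coeff p 0 = - c * coeff q 0"
    by (simp add: p)
  have coeffS: "coeff p (Suc k) = coeff q k - c * coeff q (Suc k)" for k
    by (simp add: p)
  have IH: "(\<Sum>k\<le>d. norm (coeff q k) * r ^ k) \<le> norm (coeff q 0) * (1 + r / R) ^ d"
    using Suc.hyps(1)[of q] q Suc.prems(2) unfolding p by simp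
  have top: "coeff q (Suc d) = 0"
    using q by (simp add: coeff_eq_0)
  have "(\<Sum>k\<le>Suc d. norm (coeff p k) * r ^ k)
      = norm (coeff p 0) + (\<Sum>k\<le>d. norm (coeff p (Suc k)) * r ^ Suc k)"
    by (subst sum.atMost_Suc_shift) simp
  also have "\<dots> \<le> norm (coeff p 0)
      + (\<Sum>k\<le>d. (norm (coeff q k) + norm c * norm (coeff q (Suc k))) * r ^ Suc k)"
    unfolding coeffS using \<open>r \<ge> 0\<close>
    by (intro add_left_mono sum_mono mult_right_mono)
       (auto intro: order_trans[OF norm_triangle_ineq4] simp: norm_mult)
  also have "\<dots> = norm c * (norm (coeff q 0) + (\<Sum>k\<le>d. norm (coeff q (Suc k)) * r ^ Suc k))
      + r * (\<Sum>k\<le>d. norm (coeff q k) * r ^ k)"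
    by (simp add: coeff0 norm_mult sum.distrib algebra_simps sum_distrib_left)
  also have "norm (coeff q 0) + (\<Sum>k\<le>d. norm (coeff q (Suc k)) * r ^ Suc k)
      = (\<Sum>k\<le>Suc d. norm (coeff q k) * r ^ k)"
    by (subst sum.atMost_Suc_shift) simp
  also have "\<dots> = (\<Sum>k\<le>d. norm (coeff q k) * r ^ k)"
    by (simp add: top)
  also have "norm c * \<dots> + r * \<dots> = (norm c + r) * \<dots>"
    by (simp add: algebra_simps)
  also have "\<dots> \<le> (norm c * (1 + r / R)) * (norm (coeff q 0) * (1 + r / R) ^ d)"
  proof (rule mult_mono[OF _ IH])
    have "R * r \<le> norm c * r"
      using \<open>R \<le> norm c\<close> \<open>r \<ge> 0\<close> by (rule mult_right_mono)
    then show "norm c + r \<le> norm c * (1 + r / R)"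
      using \<open>R > 0\<close> by (simp add: field_simps)
  qed (use \<open>r \<ge> 0\<close> \<open>R > 0\<close> in \<open>auto intro!: sum_nonneg mult_nonneg_nonneg add_nonneg_nonneg\<close>)
  also have "\<dots> = norm (coeff p 0) * (1 + r / R) ^ Suc d"
    by (simp add: coeff0 norm_mult mult_ac)
  finally show ?case using Suc.hyps(2) by simp
qed

text \<open>The logarithmic derivative of \<open>p\<close> at \<open>x\<close> is a sum of
  \<open>degree p\<close> terms 1/(x - z), each of modulus at most 1/\<delta>. Multiplying out
  avoids a division by \<open>poly p x\<close>, and the induction treats one linear factor at a
  time.\<close>

lemma norm_pderiv_le_of_roots_far:
  fixes p :: "complex poly"
  assumes "p \<noteq> 0" "\<delta> \<ge> 0" "\<And>z. poly p z = 0 \<Longrightarrow> \<delta> \<le> norm (x - z)"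
  shows "norm (poly (pderiv p) x) * \<delta> \<le> real (degree p) * norm (poly p x)"
  using assms(1,3)
proof (induction "degree p" arbitrary: p)
  case 0
  then have "pderiv p = 0" by (simp add: pderiv_eq_0_iff)
  then show ?case by simp
next
  case (Suc d)
  obtain c q where p: "p = [:-c, 1:] * q" and q: "degree q = d" "q \<noteq> 0" and c: "poly p c = 0"
    using complex_poly_linear_factor Suc.hyps(2) by metis
  have "\<delta> \<le> norm (x - c)" using Suc.prems(2) c by blast
  have IH: "norm (poly (pderiv q) x) * \<delta> \<le> real d * norm (poly q x)"
    using Suc.hyps(1)[of q] q Suc.prems(2) unfolding p by simp
  have "poly (pderiv p) x = poly q x + (x - c) * poly (pderiv q) x"
    unfolding p pderiv_mult by (simp add: pderiv_pCons algebra_simps)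
  then have "norm (poly (pderiv p) x) * \<delta>
      \<le> (norm (poly q x) + norm (x - c) * norm (poly (pderiv q) x)) * \<delta>"
    using assms(2) by (intro mult_right_mono) (auto intro: order_trans[OF norm_triangle_ineq] simp: norm_mult)
  also have "\<dots> = norm (poly q x) * \<delta> + norm (x - c) * (norm (poly (pderiv q) x) * \<delta>)"
    by (simp add: algebra_simps)
  also have "\<dots> \<le> norm (poly q x) * norm (x - c) + norm (x - c) * (real d * norm (poly q x))"
    using IH \<open>\<delta> \<le> norm (x - c)\<close> by (intro add_mono mult_left_mono) auto
  also have "\<dots> = real (Suc d) * norm ((x - c) * poly q x)"
    unfolding norm_mult by (simp add: algebra_simps)
  also have "(x - c) * poly q x = poly p x"
    unfolding p by (simp add: algebra_simps)
  finally show ?case using Suc.hyps(2) by simp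
qed

text \<open>Split off the root: p = (X - z) q. With d = |x - z|, p'(x) = 0 gives |q(x)| = d |q'(x)|.
  The roots of q are at least \<rho> - d away from x, so |q'(x)| (\<rho> - d) \<le> (deg p - 1)
  |q(x)|. Together: \<rho> - d \<le> (deg p - 1) d.\<close>

lemma critical_point_far_from_isolated_root:
  fixes p :: "complex poly"
  assumes "poly p z = 0" and simple: "poly (pderiv p) z \<noteq> 0"
    and far: "\<And>y. poly p y = 0 \<Longrightarrow> y \<noteq> z \<Longrightarrow> \<rho> \<le> norm (y - z)"
    and x: "poly (pderiv p) x = 0"
  shows "\<rho> \<le> real (degree p) * norm (x - z)"
proof (rule ccontr)
  define d where "d = norm (x - z)"
  assume "\<not> \<rho> \<le> real (degree p) * norm (x - z)"
  then have small: "real (degree p) * d < \<rho>" by (simp add: d_def)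
  have "p \<noteq> 0" using simple by auto
  obtain q where p: "p = [:-z, 1:] * q"
    using assms(1) unfolding poly_eq_0_iff_dvd by (elim dvdE)
  have "q \<noteq> 0" using p \<open>p \<noteq> 0\<close> by auto
  have deg: "degree p = 1 + degree q"
    unfolding p using \<open>q \<noteq> 0\<close> by (subst degree_mult_eq) auto
  have deriv: "poly (pderiv p) y = poly q y + (y - z) * poly (pderiv q) y" for y
    unfolding p pderiv_mult by (simp add: pderiv_pCons algebra_simps)
  have qz: "poly q z \<noteq> 0" using simple deriv[of z] by simp
  have d0: "d \<ge> 0" by (simp add: d_def)
  then have d_le: "d \<le> real (degree p) * d"
    by (simp add: deg algebra_simps)
  have roots: "\<rho> - d \<le> norm (x - y)" if "poly q y = 0" for y
  proof -
    have "y \<noteq> z" using that qz by auto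
    then have "\<rho> \<le> norm (y - z)" using far that unfolding p by simp
    also have "\<dots> \<le> norm (x - y) + d"
      using norm_triangle_ineq4[of "x - z" "x - y"] by (simp add: d_def)
    finally show ?thesis by simp
  qed
  \<comment> \<open>A root of \<open>q\<close> at \<open>x\<close> itself would give \<rho> \<le> d,
    against d \<le> (deg p) d < \<rho>.\<close>
  have "poly q x \<noteq> 0"
    using roots[of x] small d_le by auto
  have "poly q x = - ((x - z) * poly (pderiv q) x)"
    using x deriv[of x] by (simp add: add_eq_0_iff2)
  then have qx: "norm (poly q x) = d * norm (poly (pderiv q) x)"
    by (simp add: norm_mult d_def)
  have "norm (poly q x) * (\<rho> - d) = d * (norm (poly (pderiv q) x) * (\<rho> - d))"
    by (simp add: qx)
  also have "\<dots> \<le> d * (real (degree q) * norm (poly q x))"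
    using norm_pderiv_le_of_roots_far[OF \<open>q \<noteq> 0\<close>, of "\<rho> - d" x] roots small d_le d0
    by (intro mult_left_mono) auto
  finally have "norm (poly q x) * (\<rho> - d) \<le> norm (poly q x) * (d * real (degree q))"
    by (simp add: mult_ac)
  then have "\<rho> - d \<le> d * real (degree q)"
    using \<open>poly q x \<noteq> 0\<close> by simp
  then show False using small by (simp add: deg algebra_simps)
qed

subsection \<open>Real polynomials and their non-real roots\<close>

text \<open>The quadratic is (X - w)(X - cnj w). The remainder modulo it is real and of degree at
  most 1; such a polynomial can have a non-real root only if it is 0.\<close>

lemma conjugate_quadratic_dvd:
  fixes p :: "real poly"
  assumes "poly (cpoly p) w = 0" "Im w \<noteq> 0"
  shows "[:(cmod w)\<^sup>2, - 2 * Re w, 1:] dvd p"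
proof -
  define q where "q = [:(cmod w)\<^sup>2, - 2 * Re w, 1:]"
  define r where "r = p mod q"
  have qw: "poly (cpoly q) w = 0"
    by (simp add: q_def complex_eq_iff cmod_def power2_eq_square algebra_simps)
  have "degree q = 2" by (simp add: q_def)
  then have "degree r \<le> 1"
    using degree_mod_less[of q p] unfolding r_def by (cases "q = 0") auto
  then obtain a b where r: "r = [:a, b:]"
    by (metis One_nat_def degree_eq_zeroE degree_pCons_eq_if le_Suc_eq le_zero_eq nat.inject pCons_cases pCons_0_0)
  have "cpoly p = cpoly q * cpoly (p div q) + cpoly r"
    unfolding r_def cpoly_mult[symmetric] cpoly_add[symmetric] by simp
  then have "poly (cpoly r) w = 0"
    using assms(1) qw by simp
  then have "of_real a + w * of_real b = 0" by (simp add: r)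
  then have "a + Re w * b = 0 \<and> Im w * b = 0"
    by (simp add: complex_eq_iff)
  then have "r = 0" using assms(2) r by auto
  then show ?thesis by (simp add: r_def q_def mod_eq_0_iff_dvd)
qed

text \<open>Square-freeness is assumed over the reals, so a double complex root has to be turned
  into a real square factor: of the linear factor at a real root, of the conjugate quadratic at a
  non-real one.\<close>

lemma squarefree_imp_simple_complex_root:
  fixes p :: "real poly"
  assumes "squarefree p" "poly (cpoly p) w = 0"
  shows "poly (pderiv (cpoly p)) w \<noteq> 0"
proof
  assume deriv: "poly (pderiv (cpoly p)) w = 0"
  obtain q where q: "q\<^sup>2 dvd p" "degree q > 0"
  proof (cases "Im w = 0")
    case True
    then obtain x where w: "w = complex_of_real x"
      by (metis complex_is_Real_iff Reals_cases)
    have "poly p x = 0" using assms(2) by (simp add: w poly_cpoly_of_real)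
    then obtain g where g: "p = [:-x, 1:] * g"
      unfolding poly_eq_0_iff_dvd by (elim dvdE)
    have "poly (pderiv p) x = 0"
      using deriv by (simp add: w cpoly_pderiv[symmetric] poly_cpoly_of_real)
    then have "poly g x = 0"
      unfolding g pderiv_mult by (simp add: pderiv_pCons)
    then have "[:-x, 1:] dvd g" by (simp add: poly_eq_0_iff_dvd)
    then have "[:-x, 1:]\<^sup>2 dvd p"
      unfolding g power2_eq_square by (rule mult_dvd_mono[OF dvd_refl])
    then show thesis by (rule that) simp
  next
    case False
    define q where "q = [:(cmod w)\<^sup>2, - 2 * Re w, 1:]"
    have qw: "poly (cpoly q) w = 0"
      by (simp add: q_def complex_eq_iff cmod_def power2_eq_square algebra_simps)
    obtain g where g: "p = q * g"
      using conjugate_quadratic_dvd[OF assms(2) False] unfolding q_def by (elim dvdE)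
    \<comment> \<open>The derivative of \<open>q\<close> at \<open>w\<close> is 2 i Im w, so the
      vanishing of p'(w) = q'(w) g(w) passes to \<open>g\<close>.\<close>
    have "poly (pderiv (cpoly q)) w \<noteq> 0"
      using False by (simp add: q_def pderiv_pCons complex_eq_iff)
    then have "poly (cpoly g) w = 0"
      using deriv qw unfolding g cpoly_mult pderiv_mult by simp
    then have "q dvd g"
      unfolding q_def using False by (rule conjugate_quadratic_dvd)
    then have "q\<^sup>2 dvd p"
      unfolding g power2_eq_square by (rule mult_dvd_mono[OF dvd_refl])
    then show thesis by (rule that) (simp add: q_def)
  qed
  then have "q dvd 1" using assms(1) squarefreeD by blast
  then show False using q(2) by (auto simp: is_unit_poly_iff)
qed

lemma coeff_mult_nonneg:
  fixes p q :: "real poly"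
  assumes "\<And>i. coeff p i \<ge> 0" "\<And>i. coeff q i \<ge> 0"
  shows "coeff (p * q) i \<ge> 0"
  using assms by (auto simp: coeff_mult intro!: sum_nonneg)

text \<open>Over the reals, \<open>p\<close> is its leading coefficient times factors X - x with x
  \<le> 0 and X^2 - 2 (Re w) X + |w|^2 with Re w \<le> 0. All of these have nonnegative
  coefficients, and products keep this.\<close>

lemma coeff_nonneg_of_roots_left_half_plane:
  fixes p :: "real poly"
  assumes "lead_coeff p > 0" "\<And>z. poly (cpoly p) z = 0 \<Longrightarrow> Re z \<le> 0"
  shows "coeff p i \<ge> 0"
  using assms
proof (induction "degree p" arbitrary: p i rule: less_induct)
  case less
  have step: "coeff p i \<ge> 0"
    if pq: "p = q * g" and "degree q > 0" "lead_coeff q > 0" and nonneg: "\<And>i. coeff q i \<ge> 0" for q g i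
  proof -
    have "g \<noteq> 0" "q \<noteq> 0" using less.prems(1) pq by auto
    then have "degree g < degree p"
      using \<open>degree q > 0\<close> by (simp add: pq degree_mult_eq)
    moreover have "lead_coeff g > 0"
      using less.prems(1) \<open>lead_coeff q > 0\<close> by (simp add: pq lead_coeff_mult zero_less_mult_iff)
    ultimately have "coeff g j \<ge> 0" for j
      using less.prems(2) by (intro less.hyps) (auto simp: pq cpoly_mult)
    then show ?thesis unfolding pq using nonneg by (intro coeff_mult_nonneg)
  qed
  show ?case
  proof (cases "degree p = 0")
    case True
    then show ?thesis using less.prems(1) by (cases "i = 0") (auto simp: coeff_eq_0)
  next
    case False
    then obtain w where w: "poly (cpoly p) w = 0"
      using complex_poly_root_exists[of "cpoly p"] by auto
    then have "Re w \<le> 0" by (rule less.prems(2))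
    show ?thesis
    proof (cases "Im w = 0")
      case True
      then have "w = complex_of_real (Re w)" by (simp add: complex_eq_iff)
      then have "poly p (Re w) = 0" using w by (metis poly_cpoly_of_real of_real_eq_0_iff)
      then obtain g where "p = [:-Re w, 1:] * g"
        unfolding poly_eq_0_iff_dvd by (elim dvdE)
      then show ?thesis
        by (rule step) (use \<open>Re w \<le> 0\<close> in \<open>auto simp: coeff_pCons split: nat.split\<close>)
    next
      case False
      then obtain g where "p = [:(cmod w)\<^sup>2, - 2 * Re w, 1:] * g"
        using conjugate_quadratic_dvd[OF w False] by (elim dvdE)
      then show ?thesis
        by (rule step) (use \<open>Re w \<le> 0\<close> in \<open>auto simp: coeff_pCons split: nat.split\<close>)
    qed
  qed
qed

lemma sign_var_eq_0I:
  assumes "(\<forall>i. coeff p i \<ge> 0) \<or> (\<forall>i. coeff p i \<le> 0)"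
  shows "sign_var p = 0"
proof -
  define cs where "cs = filter (\<lambda>c. c \<noteq> 0) (coeffs p)"
  have "set cs \<subseteq> range (coeff p)"
    by (auto simp: cs_def coeffs_def split: if_splits)
  then have "(\<forall>c\<in>set cs. c \<ge> 0) \<or> (\<forall>c\<in>set cs. c \<le> 0)"
    using assms by auto
  then have "\<not> cs ! i * cs ! Suc i < 0" if "Suc i < length cs" for i
    using that nth_mem[of i cs] nth_mem[of "Suc i" cs]
    by (auto simp: not_less intro: mult_nonneg_nonneg mult_nonpos_nonpos)
  then have "{i. Suc i < length cs \<and> cs ! i * cs ! Suc i < 0} = {}" by auto
  then show ?thesis unfolding sign_var_def cs_def[symmetric] Let_def by (simp only: card.empty)
qed

text \<open>Used in contrapositive form: a sign change yields a complex root with positive real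
  part.\<close>

lemma sign_var_eq_0_of_roots_left_half_plane:
  assumes "\<And>z. poly (cpoly p) z = 0 \<Longrightarrow> Re z \<le> 0"
  shows "sign_var p = 0"
proof (rule sign_var_eq_0I)
  have neg: "cpoly (- p) = - cpoly p" by (simp add: poly_eq_iff)
  consider "p = 0" | "lead_coeff p > 0" | "lead_coeff (- p) > 0"
    by (cases "lead_coeff p" "0::real" rule: linorder_cases) auto
  then show "(\<forall>i. coeff p i \<ge> 0) \<or> (\<forall>i. coeff p i \<le> 0)"
  proof cases
    case 3
    then have "coeff (- p) i \<ge> 0" for i
      by (rule coeff_nonneg_of_roots_left_half_plane) (auto simp: neg assms)
    then show ?thesis by auto
  qed (use coeff_nonneg_of_roots_left_half_plane assms in auto)
qed

subsection \<open>The two tests of the algorithm\<close>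

lemma poly_cpoly_restrict_poly:
  "poly (cpoly (restrict_poly f I)) y = poly (cpoly f) (of_real (fst I) + of_real (width I) * y)"
  by (simp add: restrict_poly_def cpoly_pcompose poly_pcompose algebra_simps)

lemma poly_cpoly_descartes_poly:
  assumes "1 + x \<noteq> 0"
  shows "poly (cpoly (descartes_poly f I)) x
    = (1 + x) ^ degree f * poly (cpoly (restrict_poly f I)) (1 / (1 + x))"
proof -
  have "degree (restrict_poly f I) \<le> degree f"
    unfolding restrict_poly_def
    by (rule order_trans[OF degree_pcompose_le]) simp
  then have *: "poly (cpoly (restrict_poly f I)) y
      = (\<Sum>k\<le>degree f. of_real (coeff (restrict_poly f I) k) * y ^ k)" for y
    unfolding poly_altdef
    by (intro sum.mono_neutral_cong_left) (auto simp: coeff_eq_0)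
  have "poly (cpoly (descartes_poly f I)) x
      = (\<Sum>k\<le>degree f. of_real (coeff (restrict_poly f I) k) * (1 + x) ^ (degree f - k))"
    by (simp add: descartes_poly_def cpoly_sum cpoly_smult cpoly_power poly_sum)
  also have "\<dots> = (\<Sum>k\<le>degree f. (1 + x) ^ degree f *
      (of_real (coeff (restrict_poly f I) k) * (1 / (1 + x)) ^ k))"
    using assms by (intro sum.cong) (auto simp: power_diff power_one_over field_simps)
  finally show ?thesis by (simp add: * sum_distrib_left)
qed

text \<open>The map \<open>x \<mapsto> 1 / (1 + x)\<close> takes the open right half-plane to the open disc with diameter
  \<open>(0, 1)\<close>.\<close>

lemma one_circle_theorem:
  assumes "var_on f I \<noteq> 0" "width I > 0"
  obtains z where "z \<in> complex_roots f" "norm (z - of_real (midpt I)) < width I / 2"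
proof -
  obtain x where x: "poly (cpoly (descartes_poly f I)) x = 0" "Re x > 0"
    using assms(1) sign_var_eq_0_of_roots_left_half_plane unfolding var_on_def
    by (meson not_le)
  have nz: "1 + x \<noteq> 0" using x(2) by (auto simp: complex_eq_iff)
  define y where "y = 1 / (1 + x)"
  define z where "z = of_real (fst I) + of_real (width I) * y"
  have "z \<in> complex_roots f"
    using x(1) nz
    by (simp add: poly_cpoly_descartes_poly poly_cpoly_restrict_poly complex_roots_def z_def y_def)
  moreover have "norm (z - of_real (midpt I)) < width I / 2"
  proof -
    \<comment> \<open>The Cayley transform (1 - x)/(1 + x) maps Re x > 0 into the open unit disc,
      and z minus the midpoint is \<open>width I / 2\<close> times its value.\<close>
    have "z - of_real (midpt I) = of_real (width I) * (y - 1 / 2)"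
      by (simp add: z_def midpt_def width_def field_simps)
    also have "y - 1 / 2 = (1 - x) / (2 * (1 + x))"
      using nz by (simp add: y_def field_simps)
    finally have eq: "norm (z - of_real (midpt I)) = width I * (norm (1 - x) / (2 * norm (1 + x)))"
      using assms(2) by (simp only: norm_mult norm_divide) simp
    have "(norm (1 - x))\<^sup>2 < (norm (1 + x))\<^sup>2"
      unfolding cmod_power2 using x(2) by (simp add: power2_eq_square algebra_simps)
    then have "norm (1 - x) < norm (1 + x)" by (rule power_less_imp_less_base) simp
    moreover have "norm (1 + x) > 0" using nz by simp
    ultimately have "norm (1 - x) / (2 * norm (1 + x)) < 1 / 2"
      by (simp add: field_simps)
    then have "width I * (norm (1 - x) / (2 * norm (1 + x))) < width I * (1 / 2)"
      using assms(2) by (rule mult_strict_left_mono)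
    then show ?thesis using eq by simp
  qed
  ultimately show thesis by (rule that)
qed

text \<open>Roots beyond 8n make the constant coefficient dominate: by
  \<open>weighted_coeff_sum_le\<close> with radius 2, the weighted norm is at most (1 + 1/(4n))^n
  \<le> exp(1/4) \<le> 21/16 times it. The other terms thus sum to at most 5/16 of it, and 3/2 *
  5/16 < 1.\<close>

lemma t_test_of_roots_far:
  fixes p :: "real poly"
  assumes "p \<noteq> 0" "n > 0" "degree p \<le> n"
    and far: "\<And>z. poly (cpoly p) z = 0 \<Longrightarrow> 8 * real n \<le> norm z"
  shows "t_test p 0 2"
proof -
  have coeff: "poly ((pderiv ^^ k) p) 0 / fact k = coeff p k" for k
    by (simp add: poly_0_coeff_0 coeff_higher_pderiv pochhammer_fact[symmetric])
  have "poly p 0 \<noteq> 0"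
    using far[of 0] poly_cpoly_of_real[of p 0] \<open>n > 0\<close> by auto
  then have "coeff p 0 \<noteq> 0" by (simp add: poly_0_coeff_0)
  define S where "S = (\<Sum>k=1..degree p. \<bar>coeff p k\<bar> * 2 ^ k)"
  have "\<bar>coeff p 0\<bar> + S = (\<Sum>k\<le>degree p. \<bar>coeff p k\<bar> * 2 ^ k)"
    unfolding S_def by (simp add: sum.atMost_shift atMost_atLeast0 sum.atLeast_Suc_atMost)
  also have "\<dots> \<le> \<bar>coeff p 0\<bar> * (1 + 2 / (8 * real n)) ^ degree p"
    using weighted_coeff_sum_le[of "cpoly p" 2 "8 * real n"] assms by simp
  also have "(1 + 2 / (8 * real n)) ^ degree p \<le> (1 + (1/4) / real n) ^ n"
    using assms by (intro order_trans[OF power_increasing[OF \<open>degree p \<le> n\<close>]]) auto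
  also have "\<dots> \<le> exp (1/4)"
    using exp_ge_one_plus_x_over_n_power_n[of n "1/4"] \<open>n > 0\<close> by simp
  also have "exp (1/4 :: real) \<le> 1 + 1/4 + (1/4)\<^sup>2"
    by (rule exp_bound) auto
  finally have "\<bar>coeff p 0\<bar> + S \<le> \<bar>coeff p 0\<bar> * (1 + 1/4 + (1/4)\<^sup>2)"
    by (simp add: mult_left_mono)
  then have "3/2 * S < \<bar>coeff p 0\<bar>"
    using \<open>coeff p 0 \<noteq> 0\<close> by (simp add: power2_eq_square)
  then show ?thesis
    unfolding t_test_def t_test_val_def coeff S_def by (simp add: poly_0_coeff_0)
qed


section \<open>The set of complex roots\<close>

lemma finite_complex_roots: "p \<noteq> 0 \<Longrightarrow> finite (complex_roots p)"
  unfolding complex_roots_def by (rule poly_roots_finite) simp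

lemma card_complex_roots_le: "p \<noteq> 0 \<Longrightarrow> card (complex_roots p) \<le> degree p"
  unfolding complex_roots_def using card_poly_roots_bound[of "cpoly p"] by simp

text \<open>Removing the linear factor of \<open>z\<close> leaves a quotient of positive degree, and
  simplicity keeps \<open>z\<close> from being a root of it. The \<open>Min\<close> in
  \<open>root_sep\<close> is thus taken over a nonempty set.\<close>

lemma complex_roots_other:
  assumes "degree p \<ge> 2" "z \<in> complex_roots p" "poly (pderiv (cpoly p)) z \<noteq> 0"
  shows "complex_roots p - {z} \<noteq> {}"
proof -
  have "p \<noteq> 0" using assms(1) by auto
  have "poly (cpoly p) z = 0" using assms(2) by (simp add: complex_roots_def)
  then obtain q where q: "cpoly p = [:-z, 1:] * q"
    unfolding poly_eq_0_iff_dvd by (elim dvdE)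
  have "q \<noteq> 0" using q \<open>p \<noteq> 0\<close> by (metis cpoly_eq_0_iff mult_zero_right)
  have "degree (cpoly p) = 1 + degree q"
    unfolding q using \<open>q \<noteq> 0\<close> by (subst degree_mult_eq) auto
  then have "degree q > 0" using assms(1) by simp
  then obtain y where y: "poly q y = 0" by (rule complex_poly_root_exists)
  have "poly q z \<noteq> 0"
    using assms(3) unfolding q pderiv_mult by (simp add: pderiv_pCons)
  then have "y \<noteq> z" using y by auto
  moreover have "y \<in> complex_roots p" using y by (simp add: complex_roots_def q)
  ultimately show ?thesis by auto
qed

subsection \<open>The subdivision tree\<close>

text \<open>Bisection depends on \<open>f\<close> and the interval alone, not on the state. The tree
  can thus be bounded by a fixed set of intervals, whatever the order of processing.\<close>

definition splits :: "real poly \<Rightarrow> interval \<Rightarrow> bool" where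
  "splits f I \<longleftrightarrow> var_on f (enlarge (degree f) I) \<noteq> 0 \<and> \<not> t_test (pderiv (restrict_poly f I)) 0 2"

definition left_half :: "interval \<Rightarrow> interval" where
  "left_half I = (fst I, midpt I)"

definition right_half :: "interval \<Rightarrow> interval" where
  "right_half I = (midpt I, snd I)"

text \<open>The index \<open>j\<close> ranges over all integers, so intervals outside
  \<open>dcm_root\<close> are included; only upper bounds on their number are wanted.\<close>

definition dyadic_interval :: "nat \<Rightarrow> int \<Rightarrow> interval" where
  "dyadic_interval k j = (- 1/2 + of_int j / 2 ^ k, - 1/2 + (of_int j + 1) / 2 ^ k)"

definition splitting_nodes :: "real poly \<Rightarrow> interval set" where
  "splitting_nodes f = {I. splits f I \<and> (\<exists>k j. I = dyadic_interval k j)}"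

text \<open>A set fixed in advance that contains every interval a run can activate. Some members may
  never occur, as nothing is asked of the ancestors of a splitting node.\<close>

definition reachable_nodes :: "real poly \<Rightarrow> interval set" where
  "reachable_nodes f =
    insert dcm_root (left_half ` splitting_nodes f \<union> right_half ` splitting_nodes f)"

lemma width_dyadic_interval [simp]: "width (dyadic_interval k j) = 1 / 2 ^ k"
  by (simp add: width_def dyadic_interval_def add_divide_distrib)

lemma width_left_half: "width (left_half I) = width I / 2"
  by (simp add: width_def left_half_def midpt_def field_simps)

lemma width_right_half: "width (right_half I) = width I / 2"
  by (simp add: width_def right_half_def midpt_def field_simps)

lemma dcm_root_eq_dyadic: "dcm_root = dyadic_interval 0 0"
  by (simp add: dcm_root_def dyadic_interval_def)

lemma left_half_dyadic: "left_half (dyadic_interval k j) = dyadic_interval (Suc k) (2 * j)"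
  by (simp add: left_half_def dyadic_interval_def midpt_def field_simps)

lemma right_half_dyadic: "right_half (dyadic_interval k j) = dyadic_interval (Suc k) (2 * j + 1)"
  by (simp add: right_half_def dyadic_interval_def midpt_def field_simps)

lemma reachable_nodes_dyadic:
  assumes "I \<in> reachable_nodes f"
  obtains k j where "I = dyadic_interval k j"
  using assms dcm_root_eq_dyadic left_half_dyadic right_half_dyadic
  unfolding reachable_nodes_def splitting_nodes_def by blast

section \<open>Runs of the algorithm and their invariant\<close>

lemma dcm_process_splits:
  assumes "splits f I"
  shows "active (dcm_process f I s) = active s - {I} \<union> {left_half I, right_half I}"
    and "nodes (dcm_process f I s) = insert I (nodes s)"
    and "edges (dcm_process f I s) = edges s \<union> {(I, left_half I), (I, right_half I)}"
  using assms
  by (simp_all add: dcm_process_def splits_def Let_def left_half_def right_half_def)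

lemma dcm_process_not_splits:
  assumes "\<not> splits f I"
  shows "active (dcm_process f I s) = active s - {I}"
    and "nodes (dcm_process f I s) = insert I (nodes s)"
    and "edges (dcm_process f I s) = edges s"
  using assms by (auto simp: dcm_process_def splits_def Let_def)

text \<open>The clause on \<open>dcm_root\<close> puts the root among the nodes once
  \<open>active\<close> is empty, and the clause on \<open>edges\<close> makes each edge halve the
  width; both serve the height bound.\<close>

definition dcm_invariant :: "real poly \<Rightarrow> dcm_state \<Rightarrow> bool" where
  "dcm_invariant f s \<longleftrightarrow> finite (active s) \<and> active s \<union> nodes s \<subseteq> reachable_nodes f \<and>
     dcm_root \<in> active s \<union> nodes s \<and>
     edges s \<subseteq> {(I, J). J = left_half I \<or> J = right_half I}"

lemma dcm_invariant_init: "dcm_invariant f dcm_init"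
  by (simp add: dcm_invariant_def dcm_init_def reachable_nodes_def)

lemma dcm_invariant_step:
  assumes inv: "dcm_invariant f s" and "dcm_step f s s'"
  shows "dcm_invariant f s'"
proof -
  obtain I where I: "I \<in> active s" and s': "s' = dcm_process f I s"
    using assms(2) by (auto simp: dcm_step_def)
  have IT: "I \<in> reachable_nodes f" using inv I by (auto simp: dcm_invariant_def)
  show ?thesis
  proof (cases "splits f I")
    case True
    obtain k j where "I = dyadic_interval k j" using IT by (rule reachable_nodes_dyadic)
    then have "I \<in> splitting_nodes f" using True by (auto simp: splitting_nodes_def)
    then have "left_half I \<in> reachable_nodes f" "right_half I \<in> reachable_nodes f"
      by (auto simp: reachable_nodes_def)
    then show ?thesis
      using inv IT by (auto simp: dcm_invariant_def s' dcm_process_splits[OF True])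
  next
    case False
    then show ?thesis
      using inv IT by (auto simp: dcm_invariant_def s' dcm_process_not_splits[OF False])
  qed
qed

lemma dcm_invariant_reachable: "(dcm_step f)\<^sup>*\<^sup>* dcm_init s \<Longrightarrow> dcm_invariant f s"
  by (induction rule: rtranclp_induct) (auto intro: dcm_invariant_init dcm_invariant_step)

section \<open>Termination\<close>

lemma width_reachable_node_pos:
  assumes "I \<in> reachable_nodes f"
  shows "width I > 0"
proof -
  obtain k j where "I = dyadic_interval k j" using assms by (rule reachable_nodes_dyadic)
  then show ?thesis by simp
qed

text \<open>The sum of the squared widths of the active intervals is a potential: halving an interval
  replaces its contribution by half of it.\<close>

lemma dcm_potential_decrease:
  assumes inv: "dcm_invariant f s" and "dcm_step f s s'"
    and \<delta>: "\<And>I. I \<in> reachable_nodes f \<Longrightarrow> \<delta> \<le> (width I)\<^sup>2 / 2"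
  shows "(\<Sum>I\<in>active s'. (width I)\<^sup>2) \<le> (\<Sum>I\<in>active s. (width I)\<^sup>2) - \<delta>"
proof -
  obtain I where I: "I \<in> active s" and s': "s' = dcm_process f I s"
    using assms(2) by (auto simp: dcm_step_def)
  have fin: "finite (active s)" and "I \<in> reachable_nodes f"
    using inv I by (auto simp: dcm_invariant_def)
  then have \<delta>_le: "\<delta> \<le> (width I)\<^sup>2 / 2" using \<delta> by blast
  let ?w = "\<lambda>I. (width I)\<^sup>2"
  have rest: "sum ?w (active s - {I}) = sum ?w (active s) - ?w I"
    using fin I by (simp add: sum_diff1)
  show ?thesis
  proof (cases "splits f I")
    case True
    \<comment> \<open>A half might already be active, so the sum over the union is only bounded by
      the two sums.\<close>
    have "sum ?w (active s - {I} \<union> {left_half I, right_half I})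
        \<le> sum ?w (active s - {I}) + sum ?w {left_half I, right_half I}"
      using sum_Un[of "active s - {I}" "{left_half I, right_half I}" ?w] fin
      by (simp add: sum_nonneg)
    also have "sum ?w {left_half I, right_half I} \<le> ?w (left_half I) + ?w (right_half I)"
      by (cases "left_half I = right_half I") auto
    also have "\<dots> = ?w I / 2"
      by (simp add: width_left_half width_right_half power_divide)
    finally show ?thesis
      using rest \<delta>_le by (simp add: s' dcm_process_splits[OF True])
  next
    case False
    then show ?thesis
      using rest \<delta>_le zero_le_power2[of "width I"]
      by (simp only: s' dcm_process_not_splits[OF False])
  qed
qed

text \<open>Finiteness makes every step lower the nonnegative potential by a fixed positive amount,
  so no run is infinite. The invariant does not exclude that an interval is processed twice, so
  counting nodes would not suffice.\<close>

lemma dcm_terminates_if_finite: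
  assumes "finite (reachable_nodes f)"
  shows "dcm_terminates f"
proof -
  define \<delta> where "\<delta> = Min ((\<lambda>I. (width I)\<^sup>2 / 2) ` reachable_nodes f)"
  have ne: "reachable_nodes f \<noteq> {}" by (simp add: reachable_nodes_def)
  have \<delta>_le: "\<delta> \<le> (width I)\<^sup>2 / 2" if "I \<in> reachable_nodes f" for I
    unfolding \<delta>_def using assms that by (intro Min_le) auto
  have "\<delta> \<in> (\<lambda>I. (width I)\<^sup>2 / 2) ` reachable_nodes f"
    unfolding \<delta>_def using assms ne by (intro Min_in) auto
  then have "\<delta> > 0" using width_reachable_node_pos by force
  have False if S0: "S 0 = dcm_init" and step: "\<And>k. dcm_step f (S k) (S (Suc k))" for S
  proof -
    have inv: "dcm_invariant f (S k)" for k
      by (induction k) (auto simp: S0 intro: dcm_invariant_init dcm_invariant_step step)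
    define W where "W k = (\<Sum>I\<in>active (S k). (width I)\<^sup>2)" for k
    have "W k \<le> W 0 - real k * \<delta>" for k
    proof (induction k)
      case (Suc k)
      have "W (Suc k) \<le> W k - \<delta>"
        unfolding W_def using inv step \<delta>_le by (rule dcm_potential_decrease)
      then show ?case using Suc by (simp add: algebra_simps)
    qed simp
    moreover obtain k :: nat where "W 0 < real k * \<delta>"
      using \<open>\<delta> > 0\<close> reals_Archimedean3 by blast
    moreover have "W k \<ge> 0" unfolding W_def by (simp add: sum_nonneg)
    ultimately show False by (smt (verit))
  qed
  then show ?thesis unfolding dcm_terminates_def by blast
qed

text \<open>Every edge halves the width, so depth can be read off the width and a lower bound on
  widths bounds the height.\<close>

lemma width_of_path:
  assumes "dcm_invariant f s" "(dcm_root, I) \<in> edges s ^^ k"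
  shows "width I = 1 / 2 ^ k"
  using assms(2)
proof (induction k arbitrary: I)
  case 0
  then show ?case by (auto simp: dcm_root_def width_def)
next
  case (Suc k)
  then obtain P where P: "(dcm_root, P) \<in> edges s ^^ k" "(P, I) \<in> edges s" by auto
  then have "I = left_half P \<or> I = right_half P"
    using assms(1) by (auto simp: dcm_invariant_def)
  then show ?case using Suc.IH[OF P(1)] by (auto simp: width_left_half width_right_half)
qed

subsection \<open>Counting the nodes\<close>

text \<open>Roots in the disc of radius 1/2 have separations at most 1, so that each -log of a
  separation is nonnegative.\<close>

locale separated_roots =
  fixes f :: "real poly"
  assumes degree_ge_2: "degree f \<ge> 2"
    and simple_roots: "z \<in> complex_roots f \<Longrightarrow> poly (pderiv (cpoly f)) z \<noteq> 0"
    and roots_in_disc: "z \<in> complex_roots f \<Longrightarrow> cmod z \<le> 1/2"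
begin

section \<open>Separations of the roots\<close>

lemma f_nonzero: "f \<noteq> 0"
  using degree_ge_2 by auto

lemmas finite_roots = finite_complex_roots[OF f_nonzero]

lemma roots_nonempty: "complex_roots f \<noteq> {}"
  using complex_poly_root_exists[of "cpoly f"] degree_ge_2 by (auto simp: complex_roots_def)

lemma root_sep_in:
  assumes "z \<in> complex_roots f"
  shows "root_sep z f \<in> dist z ` (complex_roots f - {z})"
  unfolding root_sep_def
  using finite_roots complex_roots_other[OF degree_ge_2 assms simple_roots[OF assms]]
  by (intro Min_in) auto

lemma root_sep_le: "y \<in> complex_roots f \<Longrightarrow> y \<noteq> z \<Longrightarrow> root_sep z f \<le> dist z y"
  unfolding root_sep_def using finite_roots by (intro Min_le) auto

lemma root_sep_pos: "z \<in> complex_roots f \<Longrightarrow> root_sep z f > 0"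
  using root_sep_in by force

lemma root_sep_le_1:
  assumes "z \<in> complex_roots f"
  shows "root_sep z f \<le> 1"
proof -
  obtain y where "y \<in> complex_roots f" "root_sep z f = dist z y"
    using root_sep_in[OF assms] by auto
  then show ?thesis
    using roots_in_disc[of y] roots_in_disc[OF assms] norm_triangle_ineq4[of z y]
    by (simp add: dist_norm)
qed

lemma min_root_sep_in: "min_root_sep f \<in> (\<lambda>z. root_sep z f) ` complex_roots f"
  unfolding min_root_sep_def using finite_roots roots_nonempty by (intro Min_in) auto

lemma min_root_sep_pos: "min_root_sep f > 0"
  using min_root_sep_in root_sep_pos by auto

lemma min_root_sep_le_1: "min_root_sep f \<le> 1"
  using min_root_sep_in root_sep_le_1 by auto

lemma min_root_sep_le: "z \<in> complex_roots f \<Longrightarrow> min_root_sep f \<le> root_sep z f"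
  unfolding min_root_sep_def using finite_roots by (intro Min_le) auto

lemma log_degree_ge_1: "log 2 (real (degree f)) \<ge> 1"
  using degree_ge_2 by (simp add: le_log_iff)

text \<open>Since 32 = 2^5 and log n \<ge> 1, log c is at most 5 log n; the square adds 2 log n. It
  is applied with c = 9 and c = 18.\<close>

lemma log_bound:
  assumes "0 < c" "c \<le> 32" "0 < \<sigma>"
  shows "log 2 (c * (real (degree f))\<^sup>2 / \<sigma>) \<le> 7 * log 2 (real (degree f)) - log 2 \<sigma>"
proof -
  have n: "real (degree f) > 0" using degree_ge_2 by simp
  have "log 2 c \<le> log 2 (2 ^ 5)" using assms by (subst log_le_cancel_iff) auto
  then have "log 2 c \<le> 5" by (subst (asm) log_nat_power) auto
  moreover have "log 2 (c * (real (degree f))\<^sup>2 / \<sigma>) = log 2 c + 2 * log 2 (real (degree f)) - log 2 \<sigma>"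
    using assms n by (simp add: log_divide log_mult log_nat_power)
  ultimately show ?thesis using log_degree_ge_1 by simp
qed

lemma splits_imp_close_root:
  assumes "splits f I" and w: "width I > 0"
  obtains z where "z \<in> complex_roots f" "norm (z - of_real (midpt I)) < width I"
    "root_sep z f \<le> 9 * (real (degree f))\<^sup>2 * width I"
proof -
  define n where "n = degree f"
  define J where "J = enlarge n I"
  have n: "n \<ge> 2" using degree_ge_2 by (simp add: n_def)
  have wJ: "width J = width I + width I / (2 * real n)" and mJ: "midpt J = midpt I"
    using n by (simp_all add: J_def enlarge_def width_def midpt_def field_simps)
  \<comment> \<open>As n \<ge> 2, the enlargement adds at most a quarter of the width, so the radius
    in the one-circle theorem is at most 5/8 of \<open>width I\<close>.\<close>
  have "width I / (2 * real n) \<le> width I / 4"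
    using n w by (intro divide_left_mono) auto
  then have wJ_le: "width J \<le> 5/4 * width I" using wJ by simp
  have "width J > 0" using wJ w by (simp add: add_pos_nonneg)
  moreover have "var_on f J \<noteq> 0" using assms(1) by (simp add: splits_def J_def n_def)
  ultimately obtain z where z: "z \<in> complex_roots f" "norm (z - of_real (midpt I)) < width J / 2"
    using one_circle_theorem[of f J] mJ by metis
  have z_mid: "norm (z - of_real (midpt I)) < 5/8 * width I" using z(2) wJ_le by simp
  define p where "p = pderiv (restrict_poly f I)"
  \<comment> \<open>By the chain rule, a root \<open>y\<close> of \<open>p\<close> is a critical
    point of \<open>f\<close> in the coordinate of \<open>I\<close>; \<open>x\<close> below is that
    point.\<close>
  have p_alt: "p = smult (width I) (restrict_poly (pderiv f) I)"
    by (simp add: p_def restrict_poly_def pderiv_pcompose pderiv_pCons)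
  have deg_r: "degree (restrict_poly f I) = n"
    using w by (simp add: restrict_poly_def degree_pcompose n_def)
  then have deg_p: "degree p = n - 1" by (simp add: p_def degree_pderiv)
  then have "p \<noteq> 0" using n by auto
  moreover have "\<not> t_test p 0 2" using assms(1) by (simp add: splits_def p_def)
  ultimately obtain y where y: "poly (cpoly p) y = 0" "norm y < 8 * real n"
    using t_test_of_roots_far[of p n] deg_p n by fastforce
  define x where "x = of_real (fst I) + of_real (width I) * y"
  have x: "poly (pderiv (cpoly f)) x = 0"
    using y(1) w by (simp add: p_alt cpoly_smult poly_cpoly_restrict_poly cpoly_pderiv x_def)
  \<comment> \<open>The root of \<open>p\<close> is located relative to the left endpoint,
    \<open>z\<close> relative to the midpoint; the change of centre costs
    \<open>width I / 2\<close>.\<close>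
  have "of_real (midpt I) = (of_real (fst I) + of_real (width I / 2) :: complex)"
    by (simp add: midpt_def width_def field_simps flip: of_real_add)
  then have "x - z = (of_real (width I) * y - of_real (width I / 2)) - (z - of_real (midpt I))"
    by (simp add: x_def)
  then have "norm (x - z) \<le> norm (of_real (width I) * y - of_real (width I / 2))
      + norm (z - of_real (midpt I))"
    by (metis norm_triangle_ineq4)
  also have "norm (of_real (width I) * y - of_real (width I / 2)) \<le> width I * norm y + width I / 2"
    using norm_triangle_ineq4[of "of_real (width I) * y" "of_real (width I / 2)"] w
    by (simp add: norm_mult)
  also have "width I * norm y \<le> width I * (8 * real n)"
    using y(2) w by (intro mult_left_mono) auto
  finally have "norm (x - z) \<le> 8 * (real n * width I) + 9/8 * width I"
    using z_mid by (simp add: algebra_simps)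
  \<comment> \<open>The excess 1/2 + 5/8 = 9/8 is below 2 \<le> n, so it is absorbed by raising 8n
    to 9n.\<close>
  moreover have "2 * width I \<le> real n * width I"
    using n w by (intro mult_right_mono) auto
  ultimately have x_z: "norm (x - z) \<le> 9 * real n * width I"
    using w by (simp only: mult.assoc)
  have "root_sep z f \<le> real (degree (cpoly f)) * norm (x - z)"
  proof (rule critical_point_far_from_isolated_root[OF _ _ _ x])
    show "poly (cpoly f) z = 0" using z(1) by (simp add: complex_roots_def)
    show "poly (pderiv (cpoly f)) z \<noteq> 0" using z(1) by (rule simple_roots)
    show "root_sep z f \<le> cmod (y - z)" if "poly (cpoly f) y = 0" "y \<noteq> z" for y
      using root_sep_le[of y z] that by (simp add: complex_roots_def dist_norm norm_minus_commute)
  qed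
  also have "\<dots> \<le> real n * (9 * real n * width I)"
    using x_z by (simp add: n_def mult_left_mono)
  finally have "root_sep z f \<le> 9 * (real n)\<^sup>2 * width I"
    by (simp add: power2_eq_square mult_ac)
  moreover have "norm (z - of_real (midpt I)) < width I" using z_mid w by simp
  ultimately show thesis using that z(1) n_def by blast
qed

section \<open>Charging subdivided intervals to roots\<close>

definition max_level :: "complex \<Rightarrow> nat" where
  "max_level z = nat \<lfloor>log 2 (9 * (real (degree f))\<^sup>2 / root_sep z f)\<rfloor>"

text \<open>Levels start at 0, so there are \<open>max_level z + 1\<close> of them; the extra 1 is
  absorbed by an eighth log n.\<close>

lemma max_level_bound:
  assumes "z \<in> complex_roots f"
  shows "real (max_level z + 1) \<le> 8 * log 2 (real (degree f)) - log 2 (root_sep z f)"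
proof -
  have pos: "root_sep z f > 0" using assms by (rule root_sep_pos)
  \<comment> \<open>The logarithm is shown to be nonnegative, so that \<open>nat\<close> does not
    raise a negative value to 0.\<close>
  have "1 \<le> (real (degree f))\<^sup>2" using degree_ge_2 by simp
  then have "root_sep z f \<le> 9 * (real (degree f))\<^sup>2" using root_sep_le_1[OF assms] by simp
  then have "log 2 (9 * (real (degree f))\<^sup>2 / root_sep z f) \<ge> 0"
    using pos by (subst zero_le_log_cancel_iff) (use degree_ge_2 in \<open>auto simp: field_simps\<close>)
  then have "real (max_level z) \<le> log 2 (9 * (real (degree f))\<^sup>2 / root_sep z f)"
    unfolding max_level_def by simp
  also have "\<dots> \<le> 7 * log 2 (real (degree f)) - log 2 (root_sep z f)"
    using pos by (intro log_bound) auto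
  finally show ?thesis using log_degree_ge_1 by simp
qed

text \<open>The number 2^k (Re z + 1/2) is the position of Re z in units of level-k intervals,
  counted from the left end of \<open>dcm_root\<close>.\<close>

definition nearby :: "complex \<Rightarrow> nat \<Rightarrow> interval set" where
  "nearby z k = dyadic_interval k `
     {\<lfloor>2 ^ k * (Re z + 1/2)\<rfloor> - 1 .. \<lfloor>2 ^ k * (Re z + 1/2)\<rfloor> + 1}"

lemma finite_nearby: "finite (nearby z k)"
  by (simp add: nearby_def)

lemma card_nearby_le: "card (nearby z k) \<le> 3"
  unfolding nearby_def by (rule order_trans[OF card_image_le]) auto

text \<open>\<open>splits_imp_close_root\<close> charges each splitting node to a root; for width
  1/2^k its separation bound reads 2^k \<le> 9 n^2 / \<open>root_sep z f\<close>.\<close>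

lemma splitting_nodes_subset:
  "splitting_nodes f \<subseteq> (\<Union>z\<in>complex_roots f. \<Union>k\<le>max_level z. nearby z k)"
proof
  fix I assume "I \<in> splitting_nodes f"
  then obtain k j where I: "I = dyadic_interval k j" and "splits f I"
    by (auto simp: splitting_nodes_def)
  then obtain z where z: "z \<in> complex_roots f" "norm (z - of_real (midpt I)) < width I"
    "root_sep z f \<le> 9 * (real (degree f))\<^sup>2 * width I"
    using splits_imp_close_root[of I] by auto
  have pos: "root_sep z f > 0" using z(1) by (rule root_sep_pos)
  have "2 ^ k \<le> 9 * (real (degree f))\<^sup>2 / root_sep z f"
    using z(3) pos by (simp add: I field_simps)
  then have "real k \<le> log 2 (9 * (real (degree f))\<^sup>2 / root_sep z f)"
    by (intro le_log_of_power) auto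
  then have "k \<le> max_level z"
    unfolding max_level_def by (simp add: le_nat_iff le_floor_iff)
  moreover have "I \<in> nearby z k"
  proof -
    define t where "t = 2 ^ k * (Re z + 1/2)"
    have "\<bar>Re z - midpt I\<bar> \<le> norm (z - of_real (midpt I))"
      using abs_Re_le_cmod[of "z - of_real (midpt I)"] by simp
    then have "\<bar>Re z - midpt I\<bar> < 1 / 2 ^ k" using z(2) by (simp add: I)
    then have "2 ^ k * \<bar>Re z - midpt I\<bar> < 1" by (simp add: field_simps)
    moreover have "2 ^ k * \<bar>Re z - midpt I\<bar> = \<bar>2 ^ k * (Re z - midpt I)\<bar>"
      by (simp add: abs_mult)
    moreover have "2 ^ k * (Re z - midpt I) = t - (of_int j + 1/2)"
      by (simp add: I t_def dyadic_interval_def midpt_def field_simps)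
    ultimately have "\<bar>t - (of_int j + 1/2)\<bar> < 1" by simp
    \<comment> \<open>Here \<open>j\<close> lies strictly between t - 3/2 and t + 1/2, which leaves
      only the indices within 1 of the floor of \<open>t\<close>.\<close>
    then have "\<lfloor>t\<rfloor> - 1 \<le> j \<and> j \<le> \<lfloor>t\<rfloor> + 1" by linarith
    then show ?thesis by (auto simp: nearby_def I t_def)
  qed
  ultimately show "I \<in> (\<Union>z\<in>complex_roots f. \<Union>k\<le>max_level z. nearby z k)"
    using z(1) by auto
qed

lemma finite_splitting_nodes: "finite (splitting_nodes f)"
  by (rule finite_subset[OF splitting_nodes_subset]) (auto simp: finite_roots finite_nearby)

text \<open>Each root pays for three intervals on each of its levels. Over all roots, the negated
  logarithms of the separations add up to \<open>sum_log_sep f\<close>, and there are at most n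
  terms 8 log n.\<close>

lemma card_splitting_nodes:
  "real (card (splitting_nodes f))
    \<le> 3 * (8 * (real (degree f) * log 2 (real (degree f))) + sum_log_sep f)"
proof -
  have "card (splitting_nodes f) \<le> card (\<Union>z\<in>complex_roots f. \<Union>k\<le>max_level z. nearby z k)"
    by (rule card_mono[OF _ splitting_nodes_subset]) (auto simp: finite_roots finite_nearby)
  also have "\<dots> \<le> (\<Sum>z\<in>complex_roots f. \<Sum>k\<le>max_level z. card (nearby z k))"
    by (intro order_trans[OF card_UN_le] sum_mono card_UN_le finite_roots) auto
  also have "\<dots> \<le> (\<Sum>z\<in>complex_roots f. \<Sum>k\<le>max_level z. 3)"
    by (intro sum_mono card_nearby_le)
  finally have "real (card (splitting_nodes f))
      \<le> real (\<Sum>z\<in>complex_roots f. \<Sum>k\<le>max_level z. 3)"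
    by (simp only: of_nat_le_iff)
  also have "\<dots> = 3 * (\<Sum>z\<in>complex_roots f. real (max_level z + 1))"
    by (simp add: sum_distrib_left algebra_simps)
  also have "(\<Sum>z\<in>complex_roots f. real (max_level z + 1))
      \<le> (\<Sum>z\<in>complex_roots f. 8 * log 2 (real (degree f)) - log 2 (root_sep z f))"
    by (intro sum_mono max_level_bound)
  also have "\<dots> = 8 * (real (card (complex_roots f)) * log 2 (real (degree f))) + sum_log_sep f"
    by (simp add: sum_subtractf sum_log_sep_def)
  also have "real (card (complex_roots f)) * log 2 (real (degree f))
      \<le> real (degree f) * log 2 (real (degree f))"
    using card_complex_roots_le[OF f_nonzero] log_degree_ge_1 by (intro mult_right_mono) auto
  finally show ?thesis by simp
qed

section \<open>Bounds on the size and the height\<close>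

lemma finite_reachable_nodes: "finite (reachable_nodes f)"
  by (simp add: reachable_nodes_def finite_splitting_nodes)

lemma card_reachable_nodes: "card (reachable_nodes f) \<le> 1 + 2 * card (splitting_nodes f)"
proof -
  have "card (reachable_nodes f)
      \<le> Suc (card (left_half ` splitting_nodes f \<union> right_half ` splitting_nodes f))"
    unfolding reachable_nodes_def by (simp add: card_insert_if finite_splitting_nodes)
  also have "card (left_half ` splitting_nodes f \<union> right_half ` splitting_nodes f)
      \<le> card (left_half ` splitting_nodes f) + card (right_half ` splitting_nodes f)"
    by (rule card_Un_le)
  also have "\<dots> \<le> card (splitting_nodes f) + card (splitting_nodes f)"
    by (intro add_mono card_image_le finite_splitting_nodes)
  finally show ?thesis by simp
qed

lemma sum_log_sep_nonneg: "sum_log_sep f \<ge> 0"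
  unfolding sum_log_sep_def sum_negf[symmetric]
  using root_sep_pos root_sep_le_1 by (intro sum_nonneg) simp

lemma dcm_tree_size:
  assumes "dcm_final f s"
  shows "real (tree_size s) \<le> 49 * (sum_log_sep f + real (degree f) * log 2 (real (degree f)))"
proof -
  have "dcm_invariant f s"
    using assms dcm_invariant_reachable by (auto simp: dcm_final_def)
  then have "card (nodes s) \<le> card (reachable_nodes f)"
    by (intro card_mono finite_reachable_nodes) (auto simp: dcm_invariant_def)
  also note card_reachable_nodes
  finally have "real (tree_size s) \<le> 1 + 2 * real (card (splitting_nodes f))"
    by (simp add: tree_size_def)
  \<comment> \<open>The total is at most 1 + 2 * 3 * (8 n log n + \<open>sum_log_sep f\<close>); as
    1 \<le> n log n, the constant becomes 48 + 1 = 49.\<close>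
  moreover have "1 * 1 \<le> real (degree f) * log 2 (real (degree f))"
    using degree_ge_2 log_degree_ge_1 by (intro mult_mono) auto
  ultimately show ?thesis
    using card_splitting_nodes sum_log_sep_nonneg by simp
qed

text \<open>Every member but the root is half of a splitting node, which doubles the 9 of
  \<open>splits_imp_close_root\<close>; for the root, \<open>min_root_sep_le_1\<close>
  suffices.\<close>

lemma width_reachable_node_ge:
  assumes "I \<in> reachable_nodes f"
  shows "min_root_sep f \<le> 18 * (real (degree f))\<^sup>2 * width I"
proof -
  have n: "1 \<le> (real (degree f))\<^sup>2" using degree_ge_2 by simp
  have half: "min_root_sep f \<le> 18 * (real (degree f))\<^sup>2 * (width P / 2)" if "P \<in> splitting_nodes f" for P
  proof -
    have "width P > 0" "splits f P" using that by (auto simp: splitting_nodes_def)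
    then obtain z where z: "z \<in> complex_roots f" "root_sep z f \<le> 9 * (real (degree f))\<^sup>2 * width P"
      using splits_imp_close_root by metis
    then show ?thesis using min_root_sep_le[OF z(1)] by (simp add: mult.commute)
  qed
  have "min_root_sep f \<le> 18 * (real (degree f))\<^sup>2 * width dcm_root"
    using n min_root_sep_le_1 by (simp add: dcm_root_def width_def)
  then show ?thesis
    using assms half by (auto simp: reachable_nodes_def width_left_half width_right_half)
qed

lemma dcm_tree_height:
  assumes "dcm_final f s"
  shows "real (tree_height s) \<le> 7 * log 2 (real (degree f)) - log 2 (min_root_sep f)"
proof -
  have inv: "dcm_invariant f s" and "active s = {}"
    using assms dcm_invariant_reachable by (auto simp: dcm_final_def)
  then have root: "dcm_root \<in> nodes s" by (auto simp: dcm_invariant_def)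
  define H where "H = 7 * log 2 (real (degree f)) - log 2 (min_root_sep f)"
  define K where "K = {k. \<exists>I\<in>nodes s. (dcm_root, I) \<in> edges s ^^ k}"
  have K_le: "real k \<le> H" if k: "k \<in> K" for k
  proof -
    obtain I where I: "I \<in> nodes s" "(dcm_root, I) \<in> edges s ^^ k"
      using k unfolding K_def by blast
    have "I \<in> reachable_nodes f" using inv I(1) by (auto simp: dcm_invariant_def)
    then have "min_root_sep f \<le> 18 * (real (degree f))\<^sup>2 * (1 / 2 ^ k)"
      using width_reachable_node_ge width_of_path[OF inv I(2)] by metis
    then have "2 ^ k \<le> 18 * (real (degree f))\<^sup>2 / min_root_sep f"
      using min_root_sep_pos by (simp add: field_simps)
    then have "real k \<le> log 2 (18 * (real (degree f))\<^sup>2 / min_root_sep f)"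
      by (intro le_log_of_power) auto
    also have "\<dots> \<le> H" unfolding H_def using min_root_sep_pos by (intro log_bound) auto
    finally show ?thesis .
  qed
  \<comment> \<open>\<open>Max\<close> is meaningful only on a finite nonempty set: the depths are
    bounded, and the root has depth 0.\<close>
  have "k \<le> nat \<lfloor>H\<rfloor>" if "k \<in> K" for k
    using K_le[OF that] by linarith
  then have "K \<subseteq> {..nat \<lfloor>H\<rfloor>}" by auto
  then have "finite K" by (rule finite_subset) simp
  moreover have "0 \<in> K" using root by (auto simp: K_def)
  ultimately have "Max K \<in> K" by (intro Max_in) auto
  then show ?thesis using K_le unfolding tree_height_def K_def[symmetric] H_def by blast
qed

end

section \<open>Scaling the roots into the disc of radius 1/2\<close>

lemma separated_roots_scaled_poly:
  assumes deg: "degree F \<ge> 2" and sqf: "squarefree F"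
    and \<Gamma>: "log 2 (max_root_modulus F) \<le> real_of_int \<Gamma>"
  shows "separated_roots (scaled_poly F \<Gamma>)"
proof -
  define c :: real where "c = 2 powi (\<Gamma> + 1)"
  have c: "c > 0" by (simp add: c_def)
  have "F \<noteq> 0" using deg by auto
  define A where "A = lead_coeff F"
  have A: "A \<noteq> 0" using \<open>F \<noteq> 0\<close> by (simp add: A_def)
  have f: "scaled_poly F \<Gamma> = smult (1 / A) (F \<circ>\<^sub>p [:0, c:])"
    by (simp add: scaled_poly_def A_def c_def)
  have "cpoly (scaled_poly F \<Gamma>) = smult (of_real (1 / A)) (cpoly F \<circ>\<^sub>p [:0, of_real c:])"
    unfolding f by (simp add: cpoly_smult cpoly_pcompose)
  then have root_iff: "z \<in> complex_roots (scaled_poly F \<Gamma>) \<longleftrightarrow> of_real c * z \<in> complex_roots F"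
    and deriv: "poly (pderiv (cpoly (scaled_poly F \<Gamma>))) z
      = of_real (1 / A) * (poly (pderiv (cpoly F)) (of_real c * z) * of_real c)" for z
    using A by (simp_all add: complex_roots_def poly_pcompose pderiv_smult pderiv_pcompose
        pderiv_pCons mult.commute)
  have simple: "poly (pderiv (cpoly F)) z \<noteq> 0" if "z \<in> complex_roots F" for z
    using that squarefree_imp_simple_complex_root[OF sqf] by (simp add: complex_roots_def)
  have fin: "finite (complex_roots F)" using \<open>F \<noteq> 0\<close> by (rule finite_complex_roots)
  have max_ge: "cmod z \<le> max_root_modulus F" if "z \<in> complex_roots F" for z
    unfolding max_root_modulus_def using fin that by (intro Max_ge) auto
  obtain z where z: "z \<in> complex_roots F"
    using complex_poly_root_exists[of "cpoly F"] deg by (auto simp: complex_roots_def)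
  obtain y where y: "y \<in> complex_roots F" "y \<noteq> z"
    using complex_roots_other[OF deg z simple[OF z]] by auto
  \<comment> \<open>Two distinct roots cannot both be 0, so the largest modulus is positive and its
    logarithm is not a default value.\<close>
  have "cmod z > 0 \<or> cmod y > 0" using y(2) by auto
  then have pos: "max_root_modulus F > 0"
    using max_ge[OF z] max_ge[OF y(1)] by linarith
  then have "max_root_modulus F \<le> 2 powr real_of_int \<Gamma>"
    using \<Gamma> by (simp add: log_le_iff)
  also have "2 powr real_of_int \<Gamma> = (2::real) powi \<Gamma>"
    by (simp add: powr_real_of_int')
  also have "\<dots> = c / 2"
    by (simp add: c_def power_int_add)
  finally have max_le: "max_root_modulus F \<le> c / 2" .
  show ?thesis
  proof
    show "degree (scaled_poly F \<Gamma>) \<ge> 2"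
      unfolding f using A c deg by (simp add: degree_pcompose)
  next
    fix z assume "z \<in> complex_roots (scaled_poly F \<Gamma>)"
    then have cz: "of_real c * z \<in> complex_roots F" by (simp add: root_iff)
    then show "poly (pderiv (cpoly (scaled_poly F \<Gamma>))) z \<noteq> 0"
      using simple[OF cz] A c by (simp add: deriv)
    have "c * cmod z \<le> c * (1/2)"
      using order_trans[OF max_ge[OF cz] max_le] c by (simp only: norm_mult) simp
    then show "cmod z \<le> 1/2" using c by (simp only: mult_le_cancel_left_pos)
  qed
qed

theorem theorem12:
  shows "\<exists>C::real. C > 0 \<and>
    (\<forall>(n::nat) (F::real poly) (\<Gamma>::int).
       n \<ge> 2 \<longrightarrow> degree F = n \<longrightarrow> squarefree F \<longrightarrow> \<bar>lead_coeff F\<bar> \<ge> 1 \<longrightarrow>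
       log 2 (max_root_modulus F) \<le> real_of_int \<Gamma> \<longrightarrow>
       real_of_int \<Gamma> < 4 * log 2 (real n) + log 2 (max_root_modulus F) \<longrightarrow>
       (let f = scaled_poly F \<Gamma> in
          dcm_terminates f \<and>
          (\<forall>s. dcm_final f s \<longrightarrow>
             real (tree_height s) \<le> C * (log 2 (real n) - log 2 (min_root_sep f)) \<and>
             real (tree_size s) \<le> C * (sum_log_sep f + real n * log 2 (real n)))))"
proof (intro exI[of _ 49] conjI allI impI)
  fix n :: nat and F :: "real poly" and \<Gamma> :: int
  assume n: "n \<ge> 2" "degree F = n" and F: "squarefree F"
    and \<Gamma>: "log 2 (max_root_modulus F) \<le> real_of_int \<Gamma>"
  define f where "f = scaled_poly F \<Gamma>"
  interpret separated_roots f
    unfolding f_def using n F \<Gamma> by (intro separated_roots_scaled_poly) auto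
  have "F \<noteq> 0" using n by auto
  then have deg: "degree f = n"
    using n(2) by (simp add: f_def scaled_poly_def degree_pcompose flip: n(2))
  \<comment> \<open>With this sign, 7 log n - log \<open>min_root_sep f\<close> is at most 49 times
    the difference of the logarithms, so the constant of the size bound also serves for the
    height.\<close>
  have sep: "log 2 (min_root_sep f) \<le> 0"
    using min_root_sep_pos min_root_sep_le_1 by simp
  have "real (tree_height s) \<le> 49 * (log 2 (real n) - log 2 (min_root_sep f))"
    if "dcm_final f s" for s
    using dcm_tree_height[OF that] log_degree_ge_1 sep unfolding deg by simp
  moreover have "real (tree_size s) \<le> 49 * (sum_log_sep f + real n * log 2 (real n))"
    if "dcm_final f s" for s
    using dcm_tree_size[OF that] unfolding deg .
  ultimately show "let f = scaled_poly F \<Gamma> in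
          dcm_terminates f \<and>
          (\<forall>s. dcm_final f s \<longrightarrow>
             real (tree_height s) \<le> 49 * (log 2 (real n) - log 2 (min_root_sep f)) \<and>
             real (tree_size s) \<le> 49 * (sum_log_sep f + real n * log 2 (real n)))"
    using dcm_terminates_if_finite[OF finite_reachable_nodes] by (simp add: f_def Let_def)
qed simp

end
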